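(* Let $k$ be an algebraically closed field, let $n\geq 2$, let $Q_1,\ldots,Q_n$ be finite, connected, acyclic quivers, and let $\underline f=(f^{(1)},\ldots,f^{(n)}):\bar V\to\bar W$ be a morphism in the category $Rep_{(Q_1,\ldots,Q_n)}$ of $n$-representations, where $\bar V=(V^{(1)},\ldots,V^{(n)},\psi_2,\ldots,\psi_n)$ and $\bar W=(W^{(1)},\ldots,W^{(n)},\psi'_2,\ldots,\psi'_n)$. For each $m\in\{1,\ldots,n\}$ let $(K^{(m)},\eta^{(m)})$ be the cokernel of $f^{(m)}$ in $Rep_k(Q_m)$, realized vertexwise as $K^{(m)}_i=W^{(m)}_i/f^{(m)}_i(V^{(m)}_i)$ with $\eta^{(m)}$ the projection. For each $m\in\{2,\ldots,n\}$ and each pair of arrows $\gamma$ of $Q_{m-1}$ and $\gamma'$ of $Q_m$, let $\chi_{m,\gamma}^{\gamma'}:K^{(m-1)}_{t(\gamma)}\to K^{(m)}_{s(\gamma')}$ be the (well-defined) $k$-linear map $$\chi_{m,\gamma}^{\gamma'}\big(w+f^{(m-1)}_{t(\gamma)}(V^{(m-1)}_{t(\gamma)})\big)={\psi'}_{m,\gamma}^{\gamma'}(w)+f^{(m)}_{s(\gamma')}(V^{(m)}_{s(\gamma')}),\qquad w\in W^{(m-1)}_{t(\gamma)}.$$ Set $\underline K=(K^{(1)},\ldots,K^{(n)},\chi_2,\ldots,\chi_n)$ and $\underline\eta=(\eta^{(1)},\ldots,\eta^{(n)})$. Then the pair $(\underline K,\underline\eta)$ is the cokernel of $\underline f$ in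 $Rep_{(Q_1,\ldots,Q_n)}$.
   Context: For $m\in\{1,\ldots,n\}$ write $Q_m=(\mathsf{Q}^{(m)}_0,\mathsf{Q}^{(m)}_1,s,t)$, with vertex set $\mathsf{Q}^{(m)}_0$, arrow set $\mathsf{Q}^{(m)}_1$, and source and target maps $s,t:\mathsf{Q}^{(m)}_1\to\mathsf{Q}^{(m)}_0$. For a quiver $Q$, $Rep_k(Q)$ denotes the category of $k$-linear representations of $Q$ (a $k$-vector space $M_i$ for each vertex $i$, of arbitrary dimension, and a $k$-linear map $M_{s(\alpha)}\to M_{t(\alpha)}$ for each arrow $\alpha$; morphisms are families of linear maps, one per vertex, commuting with the arrow maps). An $n$-representation of $(Q_1,\ldots,Q_n)$ is a $(2n-1)$-tuple $\bar V=(V^{(1)},\ldots,V^{(n)},\psi_2,\ldots,\psi_n)$, where $V^{(m)}\in Rep_k(Q_m)$ for each $m\in\{1,\ldots,n\}$ and, for each $m\in\{2,\ldots,n\}$, $\psi_m$ is a collection of $k$-linear maps $$\psi_{m,\gamma}^{\gamma'}:V^{(m-1)}_{t(\gamma)}\to V^{(m)}_{s(\gamma')},$$ one for each pair of arrows $(\gamma,\gamma')\in \mathsf{Q}^{(m-1)}_1\times\mathsf{Q}^{(m)}_1$. No compatibility between the $\psi_m$ and the arrow maps is required. A morphism from $\bar V$ to $\bar W=(W^{(1)},\ldots,W^{(n)},\psi'_2,\ldots,\psi'_n)$ is an $n$-tuple $(f^{(1)},\ldots,f^{(n)})$, where $f^{(m)}:V^{(m)}\to W^{(m)}$ is a morphism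 in $Rep_k(Q_m)$ for each $m$, such that for each $m\in\{2,\ldots,n\}$ and each $(\gamma,\gamma')\in \mathsf{Q}^{(m-1)}_1\times\mathsf{Q}^{(m)}_1$, $$f^{(m)}_{s(\gamma')}\circ\psi_{m,\gamma}^{\gamma'}={\psi'}_{m,\gamma}^{\gamma'}\circ f^{(m-1)}_{t(\gamma)}.$$ Composition and identities are componentwise. This defines the category $Rep_{(Q_1,\ldots,Q_n)}$. The cokernel of a morphism $f:A\to B$ in a category with zero object is a morphism $p:B\to C$ (written as the pair $(C,p)$) such that $p\circ f=0$ and every $g:B\to D$ with $g\circ f=0$ factors as $g=h\circ p$ for a unique $h:C\to D$. The arrow maps of the cokernel representations $K^{(m)}$ are those induced by the arrow maps of $W^{(m)}$ on the quotients. *)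

theory Defs
  imports "HOL-Algebra.Algebraic_Closure" "Graph_Theory.Digraph_Component"
begin

section \<open>Vector spaces over a field, linear maps, quotients\<close>

text \<open>A vector space over a field \<open>k\<close> is a \<open>module k M\<close>, so only the additive structure and the
  scalar multiplication of the record \<open>M\<close> matter; its ring fields \<open>mult\<close> and \<open>one\<close> are junk.\<close>

definition linear_maps :: "'k ring \<Rightarrow> ('k, 'v) module \<Rightarrow> ('k, 'w) module \<Rightarrow> ('v \<Rightarrow> 'w) set" where
  "linear_maps k M N =
     {h \<in> hom (add_monoid M) (add_monoid N).
        \<forall>a\<in>carrier k. \<forall>x\<in>carrier M. h (a \<odot>\<^bsub>M\<^esub> x) = a \<odot>\<^bsub>N\<^esub> h x}"

definition quotient_space :: "('k, 'v) module \<Rightarrow> 'v set \<Rightarrow> ('k, 'v set) module" where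
  "quotient_space M U =
     \<lparr>carrier = a_rcosets\<^bsub>M\<^esub> U, monoid.mult = (\<lambda>_ _. undefined), one = undefined,
      zero = U, add = set_add M,
      smult = (\<lambda>a S. \<Union>x\<in>S. U +>\<^bsub>M\<^esub> (a \<odot>\<^bsub>M\<^esub> x))\<rparr>"

text \<open>The map \<open>x + U \<mapsto> h x + T\<close> into \<open>N / T\<close>. It is given by this formula only if
  \<open>x \<mapsto> h x + T\<close> is constant on the cosets of \<open>U\<close>; otherwise \<open>the_elem\<close> is unspecified.\<close>

definition induced_map :: "('k, 'w) module \<Rightarrow> 'w set \<Rightarrow> ('v \<Rightarrow> 'w) \<Rightarrow> 'v set \<Rightarrow> 'w set" where
  "induced_map N T h S = the_elem ((\<lambda>x. T +>\<^bsub>N\<^esub> h x) ` S)"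


section \<open>Quivers and their representations\<close>

text \<open>\<open>tail\<close> and \<open>head\<close> are the source and target maps; loops and parallel arrows are allowed in
  \<open>fin_digraph\<close>. \<open>connected\<close> refers to the underlying undirected graph (and includes
  nonemptiness), whereas \<open>cycle\<close> refers to oriented cycles, loops included.\<close>

definition finite_connected_acyclic_quiver :: "('q, 'e) pre_digraph \<Rightarrow> bool" where
  "finite_connected_acyclic_quiver Q \<longleftrightarrow>
     fin_digraph Q \<and> Digraph_Component.connected Q \<and> \<not> (\<exists>p. pre_digraph.cycle Q p)"

record ('q, 'e, 'k, 'v) qrep =
  vspace :: "'q \<Rightarrow> ('k, 'v) module"
  amap :: "'e \<Rightarrow> 'v \<Rightarrow> 'v"

definition is_qrep :: "'k ring \<Rightarrow> ('q, 'e) pre_digraph \<Rightarrow> ('q, 'e, 'k, 'v) qrep \<Rightarrow> bool" where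
  "is_qrep k Q M \<longleftrightarrow>
     (\<forall>i\<in>verts Q. module k (vspace M i)) \<and>
     (\<forall>\<alpha>\<in>arcs Q. amap M \<alpha> \<in> linear_maps k (vspace M (tail Q \<alpha>)) (vspace M (head Q \<alpha>)))"

definition is_qrep_hom ::
  "'k ring \<Rightarrow> ('q, 'e) pre_digraph \<Rightarrow> ('q, 'e, 'k, 'v) qrep \<Rightarrow> ('q, 'e, 'k, 'w) qrep
    \<Rightarrow> ('q \<Rightarrow> 'v \<Rightarrow> 'w) \<Rightarrow> bool" where
  "is_qrep_hom k Q M N f \<longleftrightarrow>
     (\<forall>i\<in>verts Q. f i \<in> linear_maps k (vspace M i) (vspace N i)) \<and>
     (\<forall>\<alpha>\<in>arcs Q. \<forall>x\<in>carrier (vspace M (tail Q \<alpha>)).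
        f (head Q \<alpha>) (amap M \<alpha> x) = amap N \<alpha> (f (tail Q \<alpha>) x))"

text \<open>Morphisms are families of total functions, so equality of morphisms out of \<open>M\<close> means
  equality on the carriers of the spaces of \<open>M\<close> at the vertices of \<open>Q\<close>.\<close>

definition qhom_eq ::
  "('q, 'e) pre_digraph \<Rightarrow> ('q, 'e, 'k, 'v) qrep \<Rightarrow> ('q \<Rightarrow> 'v \<Rightarrow> 'w) \<Rightarrow> ('q \<Rightarrow> 'v \<Rightarrow> 'w) \<Rightarrow> bool" where
  "qhom_eq Q M f g \<longleftrightarrow> (\<forall>i\<in>verts Q. \<forall>x\<in>carrier (vspace M i). f i x = g i x)"

definition qhom_comp :: "('q \<Rightarrow> 'w \<Rightarrow> 'u) \<Rightarrow> ('q \<Rightarrow> 'v \<Rightarrow> 'w) \<Rightarrow> 'q \<Rightarrow> 'v \<Rightarrow> 'u" where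
  "qhom_comp g f = (\<lambda>i. g i \<circ> f i)"

definition qhom_zero :: "('q, 'e, 'k, 'w) qrep \<Rightarrow> 'q \<Rightarrow> 'v \<Rightarrow> 'w" where
  "qhom_zero N = (\<lambda>i _. \<zero>\<^bsub>vspace N i\<^esub>)"

text \<open>The universal property quantifies over all test objects \<open>D\<close> whose spaces have elements of
  type \<open>'d\<close>. As HOL cannot quantify over types inside a formula, \<open>'d\<close> is a parameter; a theorem
  polymorphic in \<open>'d\<close> covers all test objects.\<close>

definition is_qrep_cokernel ::
  "'d itself \<Rightarrow> 'k ring \<Rightarrow> ('q, 'e) pre_digraph
    \<Rightarrow> ('q, 'e, 'k, 'v) qrep \<Rightarrow> ('q, 'e, 'k, 'w) qrep \<Rightarrow> ('q \<Rightarrow> 'v \<Rightarrow> 'w)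
    \<Rightarrow> ('q, 'e, 'k, 'c) qrep \<Rightarrow> ('q \<Rightarrow> 'w \<Rightarrow> 'c) \<Rightarrow> bool" where
  "is_qrep_cokernel _ k Q A B f C p \<longleftrightarrow>
     is_qrep k Q C \<and> is_qrep_hom k Q B C p \<and>
     qhom_eq Q A (qhom_comp p f) (qhom_zero C) \<and>
     (\<forall>(D :: ('q, 'e, 'k, 'd) qrep) g.
        is_qrep k Q D \<and> is_qrep_hom k Q B D g \<and> qhom_eq Q A (qhom_comp g f) (qhom_zero D) \<longrightarrow>
        (\<exists>h. is_qrep_hom k Q C D h \<and> qhom_eq Q B g (qhom_comp h p) \<and>
           (\<forall>h'. is_qrep_hom k Q C D h' \<and> qhom_eq Q B g (qhom_comp h' p) \<longrightarrow> qhom_eq Q C h' h)))"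

abbreviation image_at ::
  "('q, 'e, 'k, 'v) qrep \<Rightarrow> ('q \<Rightarrow> 'v \<Rightarrow> 'w) \<Rightarrow> 'q \<Rightarrow> 'w set" where
  "image_at M f i \<equiv> f i ` carrier (vspace M i)"

definition coker_qrep ::
  "('q, 'e) pre_digraph \<Rightarrow> ('q, 'e, 'k, 'v) qrep \<Rightarrow> ('q, 'e, 'k, 'w) qrep \<Rightarrow> ('q \<Rightarrow> 'v \<Rightarrow> 'w)
    \<Rightarrow> ('q, 'e, 'k, 'w set) qrep" where
  "coker_qrep Q M N f =
     \<lparr>vspace = (\<lambda>i. quotient_space (vspace N i) (image_at M f i)),
      amap = (\<lambda>\<alpha>. induced_map (vspace N (head Q \<alpha>)) (image_at M f (head Q \<alpha>)) (amap N \<alpha>))\<rparr>"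

definition coker_proj ::
  "('q, 'e, 'k, 'v) qrep \<Rightarrow> ('q, 'e, 'k, 'w) qrep \<Rightarrow> ('q \<Rightarrow> 'v \<Rightarrow> 'w) \<Rightarrow> 'q \<Rightarrow> 'w \<Rightarrow> 'w set" where
  "coker_proj M N f = (\<lambda>i w. image_at M f i +>\<^bsub>vspace N i\<^esub> w)"


section \<open>\<open>n\<close>-representations\<close>

text \<open>The quivers \<open>Q\<^sub>1, \<dots>, Q\<^sub>n\<close> form a family indexed by natural numbers, of which only the
  indices in \<open>{1..n}\<close> matter. \<open>link V m \<gamma> \<gamma>'\<close> is the map \<open>\<psi>\<close> with indices \<open>m\<close>, \<open>\<gamma>\<close> and \<open>\<gamma>'\<close>,
  which is relevant for \<open>m \<in> {2..n}\<close>.\<close>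

record ('q, 'e, 'k, 'v) nrep =
  comp_rep :: "nat \<Rightarrow> ('q, 'e, 'k, 'v) qrep"
  link :: "nat \<Rightarrow> 'e \<Rightarrow> 'e \<Rightarrow> 'v \<Rightarrow> 'v"

definition is_nrep ::
  "'k ring \<Rightarrow> nat \<Rightarrow> (nat \<Rightarrow> ('q, 'e) pre_digraph) \<Rightarrow> ('q, 'e, 'k, 'v) nrep \<Rightarrow> bool" where
  "is_nrep k n Q V \<longleftrightarrow>
     (\<forall>m\<in>{1..n}. is_qrep k (Q m) (comp_rep V m)) \<and>
     (\<forall>m\<in>{2..n}. \<forall>\<gamma>\<in>arcs (Q (m - 1)). \<forall>\<gamma>'\<in>arcs (Q m).
        link V m \<gamma> \<gamma>' \<in> linear_maps k (vspace (comp_rep V (m - 1)) (head (Q (m - 1)) \<gamma>))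
                                     (vspace (comp_rep V m) (tail (Q m) \<gamma>')))"

definition is_nrep_hom ::
  "'k ring \<Rightarrow> nat \<Rightarrow> (nat \<Rightarrow> ('q, 'e) pre_digraph)
    \<Rightarrow> ('q, 'e, 'k, 'v) nrep \<Rightarrow> ('q, 'e, 'k, 'w) nrep \<Rightarrow> (nat \<Rightarrow> 'q \<Rightarrow> 'v \<Rightarrow> 'w) \<Rightarrow> bool" where
  "is_nrep_hom k n Q V W f \<longleftrightarrow>
     (\<forall>m\<in>{1..n}. is_qrep_hom k (Q m) (comp_rep V m) (comp_rep W m) (f m)) \<and>
     (\<forall>m\<in>{2..n}. \<forall>\<gamma>\<in>arcs (Q (m - 1)). \<forall>\<gamma>'\<in>arcs (Q m).
        \<forall>x\<in>carrier (vspace (comp_rep V (m - 1)) (head (Q (m - 1)) \<gamma>)).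
          f m (tail (Q m) \<gamma>') (link V m \<gamma> \<gamma>' x)
            = link W m \<gamma> \<gamma>' (f (m - 1) (head (Q (m - 1)) \<gamma>) x))"

definition nhom_eq ::
  "nat \<Rightarrow> (nat \<Rightarrow> ('q, 'e) pre_digraph) \<Rightarrow> ('q, 'e, 'k, 'v) nrep
    \<Rightarrow> (nat \<Rightarrow> 'q \<Rightarrow> 'v \<Rightarrow> 'w) \<Rightarrow> (nat \<Rightarrow> 'q \<Rightarrow> 'v \<Rightarrow> 'w) \<Rightarrow> bool" where
  "nhom_eq n Q V f g \<longleftrightarrow> (\<forall>m\<in>{1..n}. qhom_eq (Q m) (comp_rep V m) (f m) (g m))"

definition nhom_comp ::
  "(nat \<Rightarrow> 'q \<Rightarrow> 'w \<Rightarrow> 'u) \<Rightarrow> (nat \<Rightarrow> 'q \<Rightarrow> 'v \<Rightarrow> 'w) \<Rightarrow> nat \<Rightarrow> 'q \<Rightarrow> 'v \<Rightarrow> 'u" where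
  "nhom_comp g f = (\<lambda>m. qhom_comp (g m) (f m))"

definition nhom_zero :: "('q, 'e, 'k, 'w) nrep \<Rightarrow> nat \<Rightarrow> 'q \<Rightarrow> 'v \<Rightarrow> 'w" where
  "nhom_zero W = (\<lambda>m. qhom_zero (comp_rep W m))"

definition is_nrep_cokernel ::
  "'d itself \<Rightarrow> 'k ring \<Rightarrow> nat \<Rightarrow> (nat \<Rightarrow> ('q, 'e) pre_digraph)
    \<Rightarrow> ('q, 'e, 'k, 'v) nrep \<Rightarrow> ('q, 'e, 'k, 'w) nrep \<Rightarrow> (nat \<Rightarrow> 'q \<Rightarrow> 'v \<Rightarrow> 'w)
    \<Rightarrow> ('q, 'e, 'k, 'c) nrep \<Rightarrow> (nat \<Rightarrow> 'q \<Rightarrow> 'w \<Rightarrow> 'c) \<Rightarrow> bool" where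
  "is_nrep_cokernel _ k n Q A B f C p \<longleftrightarrow>
     is_nrep k n Q C \<and> is_nrep_hom k n Q B C p \<and>
     nhom_eq n Q A (nhom_comp p f) (nhom_zero C) \<and>
     (\<forall>(D :: ('q, 'e, 'k, 'd) nrep) g.
        is_nrep k n Q D \<and> is_nrep_hom k n Q B D g \<and>
        nhom_eq n Q A (nhom_comp g f) (nhom_zero D) \<longrightarrow>
        (\<exists>h. is_nrep_hom k n Q C D h \<and> nhom_eq n Q B g (nhom_comp h p) \<and>
           (\<forall>h'. is_nrep_hom k n Q C D h' \<and> nhom_eq n Q B g (nhom_comp h' p) \<longrightarrow>
              nhom_eq n Q C h' h)))"

definition coker_nrep ::
  "(nat \<Rightarrow> ('q, 'e) pre_digraph) \<Rightarrow> ('q, 'e, 'k, 'v) nrep \<Rightarrow> ('q, 'e, 'k, 'w) nrep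
    \<Rightarrow> (nat \<Rightarrow> 'q \<Rightarrow> 'v \<Rightarrow> 'w) \<Rightarrow> ('q, 'e, 'k, 'w set) nrep" where
  "coker_nrep Q V W f =
     \<lparr>comp_rep = (\<lambda>m. coker_qrep (Q m) (comp_rep V m) (comp_rep W m) (f m)),
      link = (\<lambda>m \<gamma> \<gamma>'. induced_map (vspace (comp_rep W m) (tail (Q m) \<gamma>'))
                        (image_at (comp_rep V m) (f m) (tail (Q m) \<gamma>')) (link W m \<gamma> \<gamma>'))\<rparr>"

definition coker_nproj ::
  "('q, 'e, 'k, 'v) nrep \<Rightarrow> ('q, 'e, 'k, 'w) nrep \<Rightarrow> (nat \<Rightarrow> 'q \<Rightarrow> 'v \<Rightarrow> 'w)
    \<Rightarrow> nat \<Rightarrow> 'q \<Rightarrow> 'w \<Rightarrow> 'w set" where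
  "coker_nproj V W f = (\<lambda>m. coker_proj (comp_rep V m) (comp_rep W m) (f m))"

end

theory Submission
  imports Defs
begin

text \<open>
  Everything reduces to the universal property of the quotient of one vector space. If \<open>U\<close> is a
  subspace of \<open>M\<close> and \<open>h\<close> is linear on \<open>M\<close> and vanishes on \<open>U\<close>, then \<open>h\<close> is constant on the
  cosets of \<open>U\<close>, so \<open>S \<mapsto> the_elem (h ` S)\<close> is a linear map on \<open>M / U\<close> that sends \<open>U + x\<close> to
  \<open>h x\<close> (\<open>factor_through_quotient\<close>). Applied to the composite of a map \<open>h : M \<rightarrow> N\<close> with the
  projection \<open>N \<rightarrow> N / T\<close>, this yields the map \<open>M / U \<rightarrow> N / T\<close> induced by \<open>h\<close> whenever
  \<open>h U \<subseteq> T\<close> (\<open>induced_map_coset\<close>, \<open>induced_map_linear\<close>). The arrow maps of the cokernel and the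
  maps \<open>\<chi>\<close> are of this kind, since \<open>h U \<subseteq> T\<close> for the images \<open>U\<close>, \<open>T\<close> of a morphism is exactly
  what commutation of the morphism with \<open>h\<close> gives (\<open>square_maps_image\<close>).

  Given a test morphism \<open>g\<close> with \<open>g \<circ> f = 0\<close>, the factorization is \<open>S \<mapsto> the_elem (g ` S)\<close> at every
  vertex of every quiver. All compatibilities required of it, with the arrow maps as well as with
  the linking maps \<open>\<psi>\<close>, are squares of maps on quotients, and they commute because they commute on
  representatives. Uniqueness holds vertexwise, because the projections are surjective. In
  particular the cokernel in the category of \<open>n\<close>-representations is computed componentwise.
\<close>


section \<open>Quotients of vector spaces and maps out of them\<close>

lemma linear_maps_closed:
  "h \<in> linear_maps k M N \<Longrightarrow> x \<in> carrier M \<Longrightarrow> h x \<in> carrier N"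
  by (auto simp: linear_maps_def hom_def)

lemma linear_maps_add:
  "h \<in> linear_maps k M N \<Longrightarrow> x \<in> carrier M \<Longrightarrow> y \<in> carrier M
    \<Longrightarrow> h (x \<oplus>\<^bsub>M\<^esub> y) = h x \<oplus>\<^bsub>N\<^esub> h y"
  by (auto simp: linear_maps_def hom_def)

lemma linear_maps_smult:
  "h \<in> linear_maps k M N \<Longrightarrow> a \<in> carrier k \<Longrightarrow> x \<in> carrier M
    \<Longrightarrow> h (a \<odot>\<^bsub>M\<^esub> x) = a \<odot>\<^bsub>N\<^esub> h x"
  by (auto simp: linear_maps_def)

lemma linear_mapsI:
  assumes "\<And>x. x \<in> carrier M \<Longrightarrow> h x \<in> carrier N"
    and "\<And>x y. x \<in> carrier M \<Longrightarrow> y \<in> carrier M \<Longrightarrow> h (x \<oplus>\<^bsub>M\<^esub> y) = h x \<oplus>\<^bsub>N\<^esub> h y"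
    and "\<And>a x. a \<in> carrier k \<Longrightarrow> x \<in> carrier M \<Longrightarrow> h (a \<odot>\<^bsub>M\<^esub> x) = a \<odot>\<^bsub>N\<^esub> h x"
  shows "h \<in> linear_maps k M N"
  using assms by (auto simp: linear_maps_def hom_def)

lemma linear_maps_comp:
  assumes "h \<in> linear_maps k M N" "h' \<in> linear_maps k N P"
  shows "(\<lambda>x. h' (h x)) \<in> linear_maps k M P"
  using assms
  by (intro linear_mapsI) (simp_all add: linear_maps_closed linear_maps_add linear_maps_smult)

lemma linear_image_submodule:
  assumes M: "module k M" and N: "module k N" and h: "h \<in> linear_maps k M N"
  shows "submodule (h ` carrier M) k N"
proof -
  interpret M: module k M by fact
  interpret N: module k N by fact
  interpret h: group_hom "add_monoid M" "add_monoid N" h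
    using h by (intro group_hom.intro M.add.is_group N.add.is_group)
      (simp add: group_hom_axioms_def linear_maps_def)
  show ?thesis
  proof (intro submodule.intro submodule_axioms.intro)
    show "subgroup (h ` carrier M) (add_monoid N)"
      using h.img_is_subgroup by simp
    show "a \<odot>\<^bsub>N\<^esub> y \<in> h ` carrier M" if "a \<in> carrier k" "y \<in> h ` carrier M" for a y
      using that linear_maps_smult[OF h, symmetric] by auto
  qed
qed

lemma submodule_abelian_subgroup:
  assumes "module k M" "submodule U k M"
  shows "abelian_subgroup U M"
  using assms by (intro abelian_subgroupI3 additive_subgroupI module.axioms submodule.axioms(1))

lemma quotient_space_carrier:
  "carrier (quotient_space M U) = (\<lambda>x. U +>\<^bsub>M\<^esub> x) ` carrier M"
  by (auto simp: quotient_space_def A_RCOSETS_def')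

lemma quotient_space_zero: "\<zero>\<^bsub>quotient_space M U\<^esub> = U"
  by (simp add: quotient_space_def)

lemma quotient_space_add:
  assumes "module k M" "submodule U k M" "x \<in> carrier M" "y \<in> carrier M"
  shows "(U +>\<^bsub>M\<^esub> x) \<oplus>\<^bsub>quotient_space M U\<^esub> (U +>\<^bsub>M\<^esub> y) = U +>\<^bsub>M\<^esub> (x \<oplus>\<^bsub>M\<^esub> y)"
  using abelian_subgroup.a_rcos_sum[OF submodule_abelian_subgroup[OF assms(1,2)] assms(3,4)]
  by (simp add: quotient_space_def)

lemma coset_eq_self:
  assumes "module k M" "submodule U k M" "u \<in> U"
  shows "U +>\<^bsub>M\<^esub> u = U"
proof -
  interpret U: abelian_subgroup U M by (rule submodule_abelian_subgroup[OF assms(1,2)])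
  show ?thesis
    using assms(3) U.a_subgroup by (intro U.a_coset_join2) auto
qed

lemma coset_memE:
  assumes "y \<in> U +>\<^bsub>M\<^esub> x"
  obtains u where "u \<in> U" "y = u \<oplus>\<^bsub>M\<^esub> x"
  using assms by (auto simp: a_r_coset_def')

lemma quotient_space_smult:
  assumes M: "module k M" and U: "submodule U k M" and a: "a \<in> carrier k" and x: "x \<in> carrier M"
  shows "a \<odot>\<^bsub>quotient_space M U\<^esub> (U +>\<^bsub>M\<^esub> x) = U +>\<^bsub>M\<^esub> (a \<odot>\<^bsub>M\<^esub> x)"
proof -
  interpret M: module k M by fact
  interpret U: abelian_subgroup U M by (rule submodule_abelian_subgroup[OF M U])
  have "U +>\<^bsub>M\<^esub> (a \<odot>\<^bsub>M\<^esub> y) = U +>\<^bsub>M\<^esub> (a \<odot>\<^bsub>M\<^esub> x)" if y: "y \<in> U +>\<^bsub>M\<^esub> x" for y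
  proof -
    obtain u where u: "u \<in> U" and y_eq: "y = u \<oplus>\<^bsub>M\<^esub> x" using y by (rule coset_memE)
    have uM: "u \<in> carrier M" using u by (rule U.a_Hcarr)
    have "a \<odot>\<^bsub>M\<^esub> u \<in> U" using submodule.smult_closed[OF U a u] .
    then show ?thesis
      using a x uM coset_eq_self[OF M U] U.a_subset
      by (simp add: y_eq M.smult_r_distr M.a_coset_add_assoc[symmetric])
  qed
  then have "(\<Union>y\<in>U +>\<^bsub>M\<^esub> x. U +>\<^bsub>M\<^esub> (a \<odot>\<^bsub>M\<^esub> y)) = U +>\<^bsub>M\<^esub> (a \<odot>\<^bsub>M\<^esub> x)"
    using U.a_rcos_self[OF x] by (intro UN_constant_eq ballI)
  then show ?thesis by (simp add: quotient_space_def)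
qed

lemma quotient_space_abelian_group:
  assumes M: "module k M" and U: "submodule U k M"
  shows "abelian_group (quotient_space M U)"
proof -
  interpret M: module k M by fact
  interpret U: abelian_subgroup U M by (rule submodule_abelian_subgroup[OF M U])
  note add = quotient_space_add[OF M U]
  have zero: "\<zero>\<^bsub>quotient_space M U\<^esub> = U +>\<^bsub>M\<^esub> \<zero>\<^bsub>M\<^esub>"
    using coset_eq_self[OF M U U.zero_closed] by (simp add: quotient_space_zero)
  have inv: "\<exists>S' \<in> carrier (quotient_space M U).
      S' \<oplus>\<^bsub>quotient_space M U\<^esub> S = \<zero>\<^bsub>quotient_space M U\<^esub>"
    if S_in: "S \<in> carrier (quotient_space M U)" for S
  proof -
    obtain x where x: "x \<in> carrier M" and S: "S = U +>\<^bsub>M\<^esub> x"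
      using S_in by (auto simp: quotient_space_carrier)
    have "(U +>\<^bsub>M\<^esub> (\<ominus>\<^bsub>M\<^esub> x)) \<oplus>\<^bsub>quotient_space M U\<^esub> S = \<zero>\<^bsub>quotient_space M U\<^esub>"
      using x by (simp add: S add zero M.l_neg)
    moreover have "U +>\<^bsub>M\<^esub> (\<ominus>\<^bsub>M\<^esub> x) \<in> carrier (quotient_space M U)"
      using x by (simp add: quotient_space_carrier)
    ultimately show ?thesis by blast
  qed
  show ?thesis
  proof (rule abelian_groupI)
    show "\<exists>S' \<in> carrier (quotient_space M U).
        S' \<oplus>\<^bsub>quotient_space M U\<^esub> S = \<zero>\<^bsub>quotient_space M U\<^esub>"
      if "S \<in> carrier (quotient_space M U)" for S
      using that by (rule inv)
  qed (auto simp: quotient_space_carrier add zero M.a_ac)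
qed

lemma quotient_space_module:
  assumes M: "module k M" and U: "submodule U k M"
  shows "module k (quotient_space M U)"
proof -
  interpret M: module k M by fact
  note add = quotient_space_add[OF M U] and smult = quotient_space_smult[OF M U]
  show ?thesis
    by (rule moduleI[OF M.R.is_cring quotient_space_abelian_group[OF M U]])
      (auto simp: quotient_space_carrier add smult M.smult_l_distr M.smult_r_distr M.smult_assoc1)
qed

lemma quotient_proj_linear:
  assumes "module k M" "submodule U k M"
  shows "(\<lambda>x. U +>\<^bsub>M\<^esub> x) \<in> linear_maps k M (quotient_space M U)"
  using assms by (intro linear_mapsI)
    (simp_all add: quotient_space_carrier quotient_space_add quotient_space_smult)

lemma the_elem_image_coset:
  assumes M: "module k M" and N: "module k N" and U: "submodule U k M"
    and h: "h \<in> linear_maps k M N" and ker: "\<And>u. u \<in> U \<Longrightarrow> h u = \<zero>\<^bsub>N\<^esub>"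
    and x: "x \<in> carrier M"
  shows "the_elem (h ` (U +>\<^bsub>M\<^esub> x)) = h x"
proof (rule the_elem_image_unique)
  interpret M: module k M by fact
  interpret N: module k N by fact
  interpret U: abelian_subgroup U M by (rule submodule_abelian_subgroup[OF M U])
  show "U +>\<^bsub>M\<^esub> x \<noteq> {}" using U.a_rcos_self[OF x] by auto
  show "h y = h x" if y: "y \<in> U +>\<^bsub>M\<^esub> x" for y
  proof -
    obtain u where u: "u \<in> U" and y_eq: "y = u \<oplus>\<^bsub>M\<^esub> x" using y by (rule coset_memE)
    show ?thesis
      using u x by (simp add: y_eq linear_maps_add[OF h] ker linear_maps_closed[OF h])
  qed
qed

lemma factor_through_quotient:
  assumes M: "module k M" and N: "module k N" and U: "submodule U k M"
    and h: "h \<in> linear_maps k M N" and ker: "\<And>u. u \<in> U \<Longrightarrow> h u = \<zero>\<^bsub>N\<^esub>"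
  shows "(\<lambda>S. the_elem (h ` S)) \<in> linear_maps k (quotient_space M U) N"
proof -
  interpret M: module k M by fact
  note rep = the_elem_image_coset[OF M N U h ker]
  show ?thesis
    by (rule linear_mapsI)
      (auto simp: quotient_space_carrier quotient_space_add[OF M U] quotient_space_smult[OF M U]
        rep linear_maps_closed[OF h] linear_maps_add[OF h] linear_maps_smult[OF h])
qed

text \<open>\<open>induced_map N T h\<close> is the factorization of \<open>x \<mapsto> T + h x\<close>, so the two preceding lemmas
  specialize to it.\<close>

lemma
  assumes M: "module k M" and N: "module k N" and U: "submodule U k M" and T: "submodule T k N"
    and h: "h \<in> linear_maps k M N" and sub: "h ` U \<subseteq> T"
  shows induced_map_coset:
      "x \<in> carrier M \<Longrightarrow> induced_map N T h (U +>\<^bsub>M\<^esub> x) = T +>\<^bsub>N\<^esub> h x"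
    and induced_map_linear:
      "induced_map N T h \<in> linear_maps k (quotient_space M U) (quotient_space N T)"
proof -
  have lin: "(\<lambda>x. T +>\<^bsub>N\<^esub> h x) \<in> linear_maps k M (quotient_space N T)"
    by (rule linear_maps_comp[OF h quotient_proj_linear[OF N T]])
  have ker: "T +>\<^bsub>N\<^esub> h u = \<zero>\<^bsub>quotient_space N T\<^esub>" if "u \<in> U" for u
    using that sub coset_eq_self[OF N T] by (auto simp: quotient_space_zero)
  note Q = quotient_space_module[OF N T]
  show "induced_map N T h (U +>\<^bsub>M\<^esub> x) = T +>\<^bsub>N\<^esub> h x" if "x \<in> carrier M"
    unfolding induced_map_def by (rule the_elem_image_coset[OF M Q U lin ker that])
  show "induced_map N T h \<in> linear_maps k (quotient_space M U) (quotient_space N T)"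
    using factor_through_quotient[OF M Q U lin ker] by (simp add: induced_map_def[abs_def])
qed

lemma square_maps_image:
  assumes "\<And>x. x \<in> A \<Longrightarrow> f' (a x) = b (f x)" and "a ` A \<subseteq> A'"
  shows "b ` f ` A \<subseteq> f' ` A'"
  using assms by force


section \<open>Cokernels of quiver representations\<close>

text \<open>A morphism \<open>f : M \<rightarrow> N\<close> of representations of \<open>Q\<close>. Well-formedness of \<open>Q\<close> says that tails
  and heads of arrows are vertices, so that the hypotheses at vertices apply to them.\<close>

locale qrep_morphism =
  fixes k :: "'k ring" and Q :: "('q, 'e) pre_digraph"
    and M :: "('q, 'e, 'k, 'v) qrep" and N :: "('q, 'e, 'k, 'w) qrep" and f :: "'q \<Rightarrow> 'v \<Rightarrow> 'w"
  assumes wf: "wf_digraph Q" and M: "is_qrep k Q M" and N: "is_qrep k Q N"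
    and f: "is_qrep_hom k Q M N f"
begin

lemma tail_verts: "\<alpha> \<in> arcs Q \<Longrightarrow> tail Q \<alpha> \<in> verts Q"
  and head_verts: "\<alpha> \<in> arcs Q \<Longrightarrow> head Q \<alpha> \<in> verts Q"
  using wf by (auto simp: wf_digraph_def)

lemma cod_module: "i \<in> verts Q \<Longrightarrow> module k (vspace N i)"
  using N by (simp add: is_qrep_def)

lemma image_submodule: "i \<in> verts Q \<Longrightarrow> submodule (image_at M f i) k (vspace N i)"
  using M N f by (intro linear_image_submodule[of k "vspace M i"])
    (auto simp: is_qrep_def is_qrep_hom_def)

lemma amap_cod:
  "\<alpha> \<in> arcs Q \<Longrightarrow> amap N \<alpha> \<in> linear_maps k (vspace N (tail Q \<alpha>)) (vspace N (head Q \<alpha>))"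
  using N by (simp add: is_qrep_def)

lemma amap_image:
  assumes "\<alpha> \<in> arcs Q"
  shows "amap N \<alpha> ` image_at M f (tail Q \<alpha>) \<subseteq> image_at M f (head Q \<alpha>)"
proof (rule square_maps_image)
  show "f (head Q \<alpha>) (amap M \<alpha> x) = amap N \<alpha> (f (tail Q \<alpha>) x)"
    if "x \<in> carrier (vspace M (tail Q \<alpha>))" for x
    using f assms that by (simp add: is_qrep_hom_def)
  show "amap M \<alpha> ` carrier (vspace M (tail Q \<alpha>)) \<subseteq> carrier (vspace M (head Q \<alpha>))"
    using M assms linear_maps_closed by (fastforce simp: is_qrep_def)
qed

lemma coker_vspace_carrier:
  "carrier (vspace (coker_qrep Q M N f) i) = coker_proj M N f i ` carrier (vspace N i)"
  by (simp add: coker_qrep_def quotient_space_carrier coker_proj_def)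

lemma coker_amap_proj:
  assumes "\<alpha> \<in> arcs Q" "x \<in> carrier (vspace N (tail Q \<alpha>))"
  shows "amap (coker_qrep Q M N f) \<alpha> (coker_proj M N f (tail Q \<alpha>) x)
    = coker_proj M N f (head Q \<alpha>) (amap N \<alpha> x)"
  unfolding coker_qrep_def coker_proj_def qrep.simps
  using assms by (intro induced_map_coset[where k = k] cod_module image_submodule amap_cod amap_image
      tail_verts head_verts)

lemma coker_is_qrep: "is_qrep k Q (coker_qrep Q M N f)"
  unfolding is_qrep_def coker_qrep_def qrep.simps
  by (intro conjI ballI quotient_space_module induced_map_linear cod_module image_submodule
      amap_cod amap_image tail_verts head_verts)

lemma coker_proj_is_hom: "is_qrep_hom k Q N (coker_qrep Q M N f) (coker_proj M N f)"
  unfolding is_qrep_hom_def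
proof (intro conjI ballI)
  show "coker_proj M N f i \<in> linear_maps k (vspace N i) (vspace (coker_qrep Q M N f) i)"
    if "i \<in> verts Q" for i
    using quotient_proj_linear[OF cod_module image_submodule] that
    by (simp add: coker_proj_def coker_qrep_def)
next
  show "coker_proj M N f (head Q \<alpha>) (amap N \<alpha> x)
      = amap (coker_qrep Q M N f) \<alpha> (coker_proj M N f (tail Q \<alpha>) x)"
    if "\<alpha> \<in> arcs Q" "x \<in> carrier (vspace N (tail Q \<alpha>))" for \<alpha> x
    using coker_amap_proj[OF that] by (rule sym)
qed

lemma coker_proj_comp_zero:
  "qhom_eq Q M (qhom_comp (coker_proj M N f) f) (qhom_zero (coker_qrep Q M N f))"
  using coset_eq_self[OF cod_module image_submodule]
  by (simp add: qhom_eq_def qhom_comp_def qhom_zero_def coker_proj_def coker_qrep_def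
      quotient_space_zero)

text \<open>Two families of maps on the cokernel agree as soon as they agree after composition with the
  projection; neither needs to be a morphism.\<close>

lemma coker_proj_epi:
  assumes "qhom_eq Q N g (qhom_comp h (coker_proj M N f))"
    and "qhom_eq Q N g (qhom_comp h' (coker_proj M N f))"
  shows "qhom_eq Q (coker_qrep Q M N f) h' h"
  using assms by (simp add: qhom_eq_def qhom_comp_def coker_vspace_carrier)

end

text \<open>A morphism \<open>g\<close> into a test representation \<open>D\<close> that vanishes on the image of \<open>f\<close>.\<close>

locale qrep_test = qrep_morphism k Q M N f
  for k :: "'k ring" and Q :: "('q, 'e) pre_digraph"
    and M :: "('q, 'e, 'k, 'v) qrep" and N :: "('q, 'e, 'k, 'w) qrep" and f +
  fixes D :: "('q, 'e, 'k, 'd) qrep" and g :: "'q \<Rightarrow> 'w \<Rightarrow> 'd"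
  assumes D: "is_qrep k Q D" and g: "is_qrep_hom k Q N D g"
    and gf: "qhom_eq Q M (qhom_comp g f) (qhom_zero D)"
begin

text \<open>The factorization of \<open>g\<close> through the projection, evaluated on a coset as the common value of
  \<open>g\<close> on its elements.\<close>

definition factor_map :: "'q \<Rightarrow> 'w set \<Rightarrow> 'd" where
  "factor_map = (\<lambda>i S. the_elem (g i ` S))"

lemma test_linear: "i \<in> verts Q \<Longrightarrow> g i \<in> linear_maps k (vspace N i) (vspace D i)"
  using g by (simp add: is_qrep_hom_def)

lemma test_module: "i \<in> verts Q \<Longrightarrow> module k (vspace D i)"
  using D by (simp add: is_qrep_def)

lemma test_vanishes: "i \<in> verts Q \<Longrightarrow> y \<in> image_at M f i \<Longrightarrow> g i y = \<zero>\<^bsub>vspace D i\<^esub>"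
  using gf by (auto simp: qhom_eq_def qhom_comp_def qhom_zero_def)

lemma factor_map_proj:
  "i \<in> verts Q \<Longrightarrow> x \<in> carrier (vspace N i) \<Longrightarrow> factor_map i (coker_proj M N f i x) = g i x"
  unfolding factor_map_def coker_proj_def
  by (rule the_elem_image_coset[OF cod_module test_module image_submodule test_linear
        test_vanishes])

lemma factor_map_comp: "qhom_eq Q N g (qhom_comp factor_map (coker_proj M N f))"
  by (simp add: qhom_eq_def qhom_comp_def factor_map_proj)

lemma factor_map_is_hom: "is_qrep_hom k Q (coker_qrep Q M N f) D factor_map"
  unfolding is_qrep_hom_def
proof (intro conjI ballI)
  show "factor_map i \<in> linear_maps k (vspace (coker_qrep Q M N f) i) (vspace D i)"
    if "i \<in> verts Q" for i
    using factor_through_quotient[OF cod_module[OF that] test_module[OF that]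
        image_submodule[OF that] test_linear[OF that] test_vanishes[OF that]]
    by (simp add: coker_qrep_def factor_map_def)
next
  fix \<alpha> S assume \<alpha>: "\<alpha> \<in> arcs Q" and "S \<in> carrier (vspace (coker_qrep Q M N f) (tail Q \<alpha>))"
  then obtain x where x: "x \<in> carrier (vspace N (tail Q \<alpha>))"
    and S: "S = coker_proj M N f (tail Q \<alpha>) x"
    by (auto simp: coker_vspace_carrier)
  show "factor_map (head Q \<alpha>) (amap (coker_qrep Q M N f) \<alpha> S) = amap D \<alpha> (factor_map (tail Q \<alpha>) S)"
    using \<alpha> x g linear_maps_closed[OF amap_cod]
    by (simp add: S coker_amap_proj factor_map_proj tail_verts head_verts is_qrep_hom_def)
qed

end

theorem (in qrep_morphism) coker_is_qrep_cokernel: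
  "is_qrep_cokernel TYPE('d) k Q M N f (coker_qrep Q M N f) (coker_proj M N f)"
  unfolding is_qrep_cokernel_def
proof (intro conjI allI impI; (elim conjE)?)
  fix D :: "('q, 'e, 'k, 'd) qrep" and g
  assume "is_qrep k Q D" "is_qrep_hom k Q N D g" "qhom_eq Q M (qhom_comp g f) (qhom_zero D)"
  then interpret t: qrep_test k Q M N f D g by unfold_locales
  show "\<exists>h. is_qrep_hom k Q (coker_qrep Q M N f) D h \<and> qhom_eq Q N g (qhom_comp h (coker_proj M N f)) \<and>
           (\<forall>h'. is_qrep_hom k Q (coker_qrep Q M N f) D h' \<and>
              qhom_eq Q N g (qhom_comp h' (coker_proj M N f)) \<longrightarrow> qhom_eq Q (coker_qrep Q M N f) h' h)"
    using t.factor_map_is_hom t.factor_map_comp coker_proj_epi by blast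
qed (fact coker_is_qrep coker_proj_is_hom coker_proj_comp_zero)+


section \<open>Cokernels of \<open>n\<close>-representations\<close>

text \<open>A morphism \<open>f : V \<rightarrow> W\<close> of \<open>n\<close>-representations.\<close>

locale nrep_morphism =
  fixes k :: "'k ring" and n :: nat and Q :: "nat \<Rightarrow> ('q, 'e) pre_digraph"
    and V :: "('q, 'e, 'k, 'v) nrep" and W :: "('q, 'e, 'k, 'w) nrep"
    and f :: "nat \<Rightarrow> 'q \<Rightarrow> 'v \<Rightarrow> 'w"
  assumes wf: "\<And>m. m \<in> {1..n} \<Longrightarrow> wf_digraph (Q m)"
    and V: "is_nrep k n Q V" and W: "is_nrep k n Q W" and f: "is_nrep_hom k n Q V W f"
begin

lemma component: "m \<in> {1..n} \<Longrightarrow> qrep_morphism k (Q m) (comp_rep V m) (comp_rep W m) (f m)"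
  using wf V W f by (simp add: qrep_morphism_def is_nrep_def is_nrep_hom_def)

lemma pred_index: "m \<in> {2..n} \<Longrightarrow> m - 1 \<in> {1..n}"
  and index: "m \<in> {2..n} \<Longrightarrow> m \<in> {1..n}"
  by auto

text \<open>The linking map \<open>\<psi>\<close> of the codomain maps the image of \<open>f\<close> into the image of \<open>f\<close>; hence \<open>\<chi>\<close>
  is well defined and linear.\<close>

lemma
  assumes m: "m \<in> {2..n}" and \<gamma>: "\<gamma> \<in> arcs (Q (m - 1))" and \<gamma>': "\<gamma>' \<in> arcs (Q m)"
  shows coker_link_proj:
      "w \<in> carrier (vspace (comp_rep W (m - 1)) (head (Q (m - 1)) \<gamma>))
        \<Longrightarrow> link (coker_nrep Q V W f) m \<gamma> \<gamma>' (coker_nproj V W f (m - 1) (head (Q (m - 1)) \<gamma>) w)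
          = coker_nproj V W f m (tail (Q m) \<gamma>') (link W m \<gamma> \<gamma>' w)"
    and coker_link_linear:
      "link (coker_nrep Q V W f) m \<gamma> \<gamma>' \<in>
        linear_maps k (vspace (comp_rep (coker_nrep Q V W f) (m - 1)) (head (Q (m - 1)) \<gamma>))
          (vspace (comp_rep (coker_nrep Q V W f) m) (tail (Q m) \<gamma>'))"
proof -
  let ?i = "head (Q (m - 1)) \<gamma>" and ?j = "tail (Q m) \<gamma>'"
  interpret P: qrep_morphism k "Q (m - 1)" "comp_rep V (m - 1)" "comp_rep W (m - 1)" "f (m - 1)"
    by (rule component[OF pred_index[OF m]])
  interpret C: qrep_morphism k "Q m" "comp_rep V m" "comp_rep W m" "f m"
    by (rule component[OF index[OF m]])
  have i: "?i \<in> verts (Q (m - 1))" and j: "?j \<in> verts (Q m)"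
    using P.head_verts[OF \<gamma>] C.tail_verts[OF \<gamma>'] .
  have link_W: "link W m \<gamma> \<gamma>'
      \<in> linear_maps k (vspace (comp_rep W (m - 1)) ?i) (vspace (comp_rep W m) ?j)"
    and link_V: "link V m \<gamma> \<gamma>'
      \<in> linear_maps k (vspace (comp_rep V (m - 1)) ?i) (vspace (comp_rep V m) ?j)"
    using V W m \<gamma> \<gamma>' by (auto simp: is_nrep_def)
  have sub: "link W m \<gamma> \<gamma>' ` image_at (comp_rep V (m - 1)) (f (m - 1)) ?i
      \<subseteq> image_at (comp_rep V m) (f m) ?j"
  proof (rule square_maps_image)
    show "f m ?j (link V m \<gamma> \<gamma>' x) = link W m \<gamma> \<gamma>' (f (m - 1) ?i x)"
      if "x \<in> carrier (vspace (comp_rep V (m - 1)) ?i)" for x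
      using f m \<gamma> \<gamma>' that by (simp add: is_nrep_hom_def)
    show "link V m \<gamma> \<gamma>' ` carrier (vspace (comp_rep V (m - 1)) ?i)
        \<subseteq> carrier (vspace (comp_rep V m) ?j)"
      using linear_maps_closed[OF link_V] by auto
  qed
  note hyps = P.cod_module[OF i] C.cod_module[OF j] P.image_submodule[OF i] C.image_submodule[OF j]
    link_W sub
  show "link (coker_nrep Q V W f) m \<gamma> \<gamma>' (coker_nproj V W f (m - 1) ?i w)
      = coker_nproj V W f m ?j (link W m \<gamma> \<gamma>' w)"
    if "w \<in> carrier (vspace (comp_rep W (m - 1)) ?i)"
    using induced_map_coset[OF hyps that]
    by (simp add: coker_nrep_def coker_nproj_def coker_proj_def)
  show "link (coker_nrep Q V W f) m \<gamma> \<gamma>' \<in>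
      linear_maps k (vspace (comp_rep (coker_nrep Q V W f) (m - 1)) ?i)
        (vspace (comp_rep (coker_nrep Q V W f) m) ?j)"
    using induced_map_linear[OF hyps] by (simp add: coker_nrep_def coker_qrep_def)
qed

lemma coker_component:
  "comp_rep (coker_nrep Q V W f) m = coker_qrep (Q m) (comp_rep V m) (comp_rep W m) (f m)"
  by (simp add: coker_nrep_def)

lemma coker_proj_component:
  "coker_nproj V W f m = coker_proj (comp_rep V m) (comp_rep W m) (f m)"
  by (simp add: coker_nproj_def)

lemma coker_is_nrep: "is_nrep k n Q (coker_nrep Q V W f)"
  unfolding is_nrep_def
  using qrep_morphism.coker_is_qrep[OF component] coker_link_linear
  by (simp add: coker_component)

lemma coker_nproj_is_hom: "is_nrep_hom k n Q W (coker_nrep Q V W f) (coker_nproj V W f)"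
  unfolding is_nrep_hom_def
  using qrep_morphism.coker_proj_is_hom[OF component] coker_link_proj
  by (simp add: coker_component coker_proj_component)

lemma coker_nproj_comp_zero:
  "nhom_eq n Q V (nhom_comp (coker_nproj V W f) f) (nhom_zero (coker_nrep Q V W f))"
  using qrep_morphism.coker_proj_comp_zero[OF component]
  by (simp add: nhom_eq_def nhom_comp_def nhom_zero_def coker_component coker_proj_component)

lemma coker_nproj_epi:
  assumes "nhom_eq n Q W g (nhom_comp h (coker_nproj V W f))"
    and "nhom_eq n Q W g (nhom_comp h' (coker_nproj V W f))"
  shows "nhom_eq n Q (coker_nrep Q V W f) h' h"
  unfolding nhom_eq_def coker_component
proof
  fix m assume m: "m \<in> {1..n}"
  show "qhom_eq (Q m) (coker_qrep (Q m) (comp_rep V m) (comp_rep W m) (f m)) (h' m) (h m)"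
    using assms m by (intro qrep_morphism.coker_proj_epi[OF component[OF m], of "g m"])
      (simp_all add: nhom_eq_def nhom_comp_def coker_proj_component)
qed

lemma coker_factorization:
  assumes D: "is_nrep k n Q D" and g: "is_nrep_hom k n Q W D g"
    and gf: "nhom_eq n Q V (nhom_comp g f) (nhom_zero D)"
  obtains h where "is_nrep_hom k n Q (coker_nrep Q V W f) D h"
    and "nhom_eq n Q W g (nhom_comp h (coker_nproj V W f))"
proof
  define h where "h = (\<lambda>m i S. the_elem (g m i ` S))"
  have test: "qrep_test k (Q m) (comp_rep V m) (comp_rep W m) (f m) (comp_rep D m) (g m)"
    if "m \<in> {1..n}" for m
    using component[OF that] D g gf that
    by (simp add: qrep_test_def qrep_test_axioms_def is_nrep_def is_nrep_hom_def nhom_eq_def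
        nhom_comp_def nhom_zero_def)
  have h_factor: "h m = qrep_test.factor_map (g m)" if "m \<in> {1..n}" for m
    using qrep_test.factor_map_def[OF test[OF that]] by (simp add: h_def)
  have h_proj: "h m i (coker_nproj V W f m i x) = g m i x"
    if "m \<in> {1..n}" "i \<in> verts (Q m)" "x \<in> carrier (vspace (comp_rep W m) i)" for m i x
    using qrep_test.factor_map_proj[OF test] that by (simp add: h_factor coker_proj_component)
  show "nhom_eq n Q W g (nhom_comp h (coker_nproj V W f))"
    by (simp add: nhom_eq_def qhom_eq_def nhom_comp_def qhom_comp_def h_proj)
  show "is_nrep_hom k n Q (coker_nrep Q V W f) D h"
    unfolding is_nrep_hom_def
  proof (intro conjI ballI)
    show "is_qrep_hom k (Q m) (comp_rep (coker_nrep Q V W f) m) (comp_rep D m) (h m)"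
      if "m \<in> {1..n}" for m
      using qrep_test.factor_map_is_hom[OF test] that by (simp add: h_factor coker_component)
  next
    fix m \<gamma> \<gamma>' S
    let ?i = "head (Q (m - 1)) \<gamma>" and ?j = "tail (Q m) \<gamma>'"
    assume m: "m \<in> {2..n}" and \<gamma>: "\<gamma> \<in> arcs (Q (m - 1))" and \<gamma>': "\<gamma>' \<in> arcs (Q m)"
      and "S \<in> carrier (vspace (comp_rep (coker_nrep Q V W f) (m - 1)) ?i)"
    \<comment> \<open>The square for \<open>h\<close> is checked on a representative \<open>w\<close> of the coset \<open>S\<close>, where it becomes
      the square for \<open>g\<close>.\<close>
    then obtain w where w: "w \<in> carrier (vspace (comp_rep W (m - 1)) ?i)"
      and S: "S = coker_nproj V W f (m - 1) ?i w"
      using qrep_morphism.coker_vspace_carrier[OF component[OF pred_index[OF m]]]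
      by (auto simp: coker_component coker_proj_component)
    have i: "?i \<in> verts (Q (m - 1))" and j: "?j \<in> verts (Q m)"
      using qrep_morphism.head_verts[OF component[OF pred_index[OF m]] \<gamma>]
        qrep_morphism.tail_verts[OF component[OF index[OF m]] \<gamma>'] .
    have lw: "link W m \<gamma> \<gamma>' w \<in> carrier (vspace (comp_rep W m) ?j)"
      using W m \<gamma> \<gamma>' by (intro linear_maps_closed[OF _ w, of _ k]) (simp add: is_nrep_def)
    have "h m ?j (link (coker_nrep Q V W f) m \<gamma> \<gamma>' S) = g m ?j (link W m \<gamma> \<gamma>' w)"
      by (simp only: S coker_link_proj[OF m \<gamma> \<gamma>' w] h_proj[OF index[OF m] j lw])
    also have "\<dots> = link D m \<gamma> \<gamma>' (g (m - 1) ?i w)"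
      using g m \<gamma> \<gamma>' w by (simp add: is_nrep_hom_def)
    also have "\<dots> = link D m \<gamma> \<gamma>' (h (m - 1) ?i S)"
      by (simp only: S h_proj[OF pred_index[OF m] i w])
    finally show "h m ?j (link (coker_nrep Q V W f) m \<gamma> \<gamma>' S) = link D m \<gamma> \<gamma>' (h (m - 1) ?i S)" .
  qed
qed

theorem coker_is_nrep_cokernel:
  "is_nrep_cokernel TYPE('d) k n Q V W f (coker_nrep Q V W f) (coker_nproj V W f)"
  unfolding is_nrep_cokernel_def
proof (intro conjI allI impI; (elim conjE)?)
  fix D :: "('q, 'e, 'k, 'd) nrep" and g
  assume "is_nrep k n Q D" "is_nrep_hom k n Q W D g"
    "nhom_eq n Q V (nhom_comp g f) (nhom_zero D)"
  then obtain h where "is_nrep_hom k n Q (coker_nrep Q V W f) D h"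
    and "nhom_eq n Q W g (nhom_comp h (coker_nproj V W f))"
    by (rule coker_factorization)
  then show "\<exists>h. is_nrep_hom k n Q (coker_nrep Q V W f) D h \<and>
      nhom_eq n Q W g (nhom_comp h (coker_nproj V W f)) \<and>
      (\<forall>h'. is_nrep_hom k n Q (coker_nrep Q V W f) D h' \<and>
        nhom_eq n Q W g (nhom_comp h' (coker_nproj V W f)) \<longrightarrow>
        nhom_eq n Q (coker_nrep Q V W f) h' h)"
    using coker_nproj_epi by blast
qed (fact coker_is_nrep coker_nproj_is_hom coker_nproj_comp_zero)+

end

theorem proposition4p5:
  fixes k :: "'k ring"
    and n :: nat
    and Q :: "nat \<Rightarrow> ('q, 'e) pre_digraph"
    and V :: "('q, 'e, 'k, 'v) nrep"
    and W :: "('q, 'e, 'k, 'w) nrep"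
    and f :: "nat \<Rightarrow> 'q \<Rightarrow> 'v \<Rightarrow> 'w"
  assumes "algebraically_closed k"
    and "n \<ge> 2"
    and "\<And>m. m \<in> {1..n} \<Longrightarrow> finite_connected_acyclic_quiver (Q m)"
    and "is_nrep k n Q V"
    and "is_nrep k n Q W"
    and "is_nrep_hom k n Q V W f"
  defines "K \<equiv> coker_nrep Q V W f"
    and "\<eta> \<equiv> coker_nproj V W f"
  shows "(\<forall>m\<in>{1..n}. is_qrep_cokernel TYPE('d) k (Q m) (comp_rep V m) (comp_rep W m) (f m)
                        (comp_rep K m) (\<eta> m)) \<and>
    (\<forall>m\<in>{2..n}. \<forall>\<gamma>\<in>arcs (Q (m - 1)). \<forall>\<gamma>'\<in>arcs (Q m).
       \<forall>w\<in>carrier (vspace (comp_rep W (m - 1)) (head (Q (m - 1)) \<gamma>)).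
         link K m \<gamma> \<gamma>' (image_at (comp_rep V (m - 1)) (f (m - 1)) (head (Q (m - 1)) \<gamma>)
                          +>\<^bsub>vspace (comp_rep W (m - 1)) (head (Q (m - 1)) \<gamma>)\<^esub> w)
         = image_at (comp_rep V m) (f m) (tail (Q m) \<gamma>')
             +>\<^bsub>vspace (comp_rep W m) (tail (Q m) \<gamma>')\<^esub> link W m \<gamma> \<gamma>' w) \<and>
    is_nrep_cokernel TYPE('d) k n Q V W f K \<eta>"
proof -
  have wf: "wf_digraph (Q m)" if "m \<in> {1..n}" for m
    using assms(3)[OF that] by (simp add: finite_connected_acyclic_quiver_def fin_digraph_def)
  interpret nrep_morphism k n Q V W f
    using wf assms(4-6) by (rule nrep_morphism.intro)
  show ?thesis
    unfolding K_def \<eta>_def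
  proof (intro conjI ballI)
    show "is_qrep_cokernel TYPE('d) k (Q m) (comp_rep V m) (comp_rep W m) (f m)
        (comp_rep (coker_nrep Q V W f) m) (coker_nproj V W f m)" if "m \<in> {1..n}" for m
      using qrep_morphism.coker_is_qrep_cokernel[OF component[OF that]]
      by (simp add: coker_component coker_proj_component)
  next
    fix m \<gamma> \<gamma>' w
    assume "m \<in> {2..n}" "\<gamma> \<in> arcs (Q (m - 1))" "\<gamma>' \<in> arcs (Q m)"
      and "w \<in> carrier (vspace (comp_rep W (m - 1)) (head (Q (m - 1)) \<gamma>))"
    then show "link (coker_nrep Q V W f) m \<gamma> \<gamma>'
          (image_at (comp_rep V (m - 1)) (f (m - 1)) (head (Q (m - 1)) \<gamma>)
            +>\<^bsub>vspace (comp_rep W (m - 1)) (head (Q (m - 1)) \<gamma>)\<^esub> w)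
        = image_at (comp_rep V m) (f m) (tail (Q m) \<gamma>')
            +>\<^bsub>vspace (comp_rep W m) (tail (Q m) \<gamma>')\<^esub> link W m \<gamma> \<gamma>' w"
      using coker_link_proj by (simp add: coker_nproj_def coker_proj_def)
  next
    show "is_nrep_cokernel TYPE('d) k n Q V W f (coker_nrep Q V W f) (coker_nproj V W f)"
      by (rule coker_is_nrep_cokernel)
  qed
qed

end
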